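(* Let $n(s),d(s)\in\mathbb{C}[s]$ be coprime polynomials and let $\nu=\max(\deg n,\deg d)$. Let $k=\nu+1$ and let $q>\nu$ be an integer. Let $\lambda_1,\dots,\lambda_k,\mu_1,\dots,\mu_q\in\mathbb{C}$ be mutually distinct points with $d(\lambda_j)\neq 0$ for all $j$ and $d(\mu_i)\neq 0$ for all $i$. Put $w_j=n(\lambda_j)/d(\lambda_j)$ and $v_i=n(\mu_i)/d(\mu_i)$, and let $\mathbb{L}\in\mathbb{C}^{q\times k}$ be the Loewner matrix with entries $$(\mathbb{L})_{i,j}=\frac{v_i-w_j}{\mu_i-\lambda_j}.$$ Let $V_\lambda\in\mathbb{C}^{\nu\times k}$ be the Vandermonde matrix $(V_\lambda)_{i,j}=\lambda_j^{\,i-1}$, let $\Delta_\lambda=\mathrm{diag}(d(\lambda_1),\dots,d(\lambda_k))$, and let $\gamma=(\gamma_1,\dots,\gamma_k)^\top\in\mathbb{C}^k$ be the vector of Lagrange coefficients of $\lambda_1,\dots,\lambda_k$. Then the right null space of $V_\lambda$ is spanned by $\gamma$, and therefore the right null space of $\mathbb{L}$ is spanned by the vector $$\Delta_\lambda\gamma=\begin{bmatrix}\gamma_1 d(\lambda_1)&\gamma_2 d(\lambda_2)&\cdots&\gamma_k d(\lambda_k)\end{bmatrix}^\top\in\mathbb{C}^k .$$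
   Context: For mutually distinct $\lambda_1,\dots,\lambda_k\in\mathbb{C}$, the Lagrange coefficients are $\gamma_j=1/\prod_{1\le i\le k,\ i\neq j}(\lambda_j-\lambda_i)$ for $j=1,\dots,k$ (an empty product equals $1$). The right null space of a matrix $M\in\mathbb{C}^{p\times k}$ is $\{c\in\mathbb{C}^k: Mc=0\}$. *)

theory Defs
  imports
    Complex_Main
    "HOL-Computational_Algebra.Polynomial"
    "Jordan_Normal_Form.Matrix_Kernel"
begin

(* Rows, columns and families of points are numbered from 0, so the k points
   are lam 0, ..., lam (k - 1). *)

definition lagrange_coeff :: "nat \<Rightarrow> (nat \<Rightarrow> complex) \<Rightarrow> nat \<Rightarrow> complex" where
  "lagrange_coeff k lam j = 1 / (\<Prod>i\<in>{..<k} - {j}. (lam j - lam i))"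

definition lagrange_vec :: "nat \<Rightarrow> (nat \<Rightarrow> complex) \<Rightarrow> complex vec" where
  "lagrange_vec k lam = vec k (lagrange_coeff k lam)"

definition vandermonde_mat :: "nat \<Rightarrow> nat \<Rightarrow> (nat \<Rightarrow> complex) \<Rightarrow> complex mat" where
  "vandermonde_mat r k lam = mat r k (\<lambda>(i, j). lam j ^ i)"

definition loewner_mat ::
  "nat \<Rightarrow> nat \<Rightarrow> (nat \<Rightarrow> complex) \<Rightarrow> (nat \<Rightarrow> complex) \<Rightarrow> (nat \<Rightarrow> complex) \<Rightarrow> (nat \<Rightarrow> complex) \<Rightarrow> complex mat"
  where
  "loewner_mat q k mu v lam w = mat q k (\<lambda>(i, j). (v i - w j) / (mu i - lam j))"

(* The linear span in the library's vector space of complex vectors of dimension k;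
   meaningful for S a subset of carrier_vec k. *)
abbreviation cspan :: "nat \<Rightarrow> complex vec set \<Rightarrow> complex vec set" where
  "cspan k S \<equiv> LinearCombinations.module.span class_ring (module_vec TYPE(complex) k) S"

end

theory Submission
  imports
    Defs
    "HOL-Computational_Algebra.Polynomial_Factorial"
    "HOL-Computational_Algebra.Field_as_Ring"
begin

text \<open>
  Let \<open>\<omega>\<close> be the monic polynomial with simple roots at the points \<open>\<lambda>\<^sub>j\<close> and let
  \<open>\<omega>\<^sub>j = \<omega> / (s - \<lambda>\<^sub>j)\<close>. Since \<open>\<omega>\<^sub>j(\<lambda>\<^sub>j) = 1 / \<gamma>\<^sub>j\<close>, the polynomial \<open>\<Sum>\<^sub>j y\<^sub>j \<omega>\<^sub>j\<close> takes
  the value \<open>y\<^sub>j / \<gamma>\<^sub>j\<close> at \<open>\<lambda>\<^sub>j\<close>, and its coefficient in degree \<open>k - 1\<close> is \<open>\<Sum>\<^sub>j y\<^sub>j\<close>. With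
  \<open>y\<^sub>j = \<gamma>\<^sub>j p(\<lambda>\<^sub>j)\<close> it is therefore \<open>p\<close> itself whenever \<open>deg p < k\<close>.

  Comparing top coefficients shows that \<open>\<gamma>\<close> annihilates the values of every polynomial of
  degree less than \<open>k - 1\<close>, which is membership in the null space of the Vandermonde matrix.
  Conversely, testing an annihilating vector \<open>c\<close> against \<open>\<omega> / ((s - \<lambda>\<^sub>0)(s - \<lambda>\<^sub>j))\<close> relates
  only \<open>c\<^sub>0\<close> and \<open>c\<^sub>j\<close>, and forces \<open>c\<^sub>j / \<gamma>\<^sub>j = c\<^sub>0 / \<gamma>\<^sub>0\<close>.

  For the Loewner matrix the same polynomials serve as barycentric numerators.
  Put \<open>N = \<Sum>\<^sub>j c\<^sub>j \<omega>\<^sub>j\<close> and \<open>D = \<Sum>\<^sub>j c\<^sub>j w\<^sub>j \<omega>\<^sub>j\<close>. Row \<open>i\<close> of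
  the matrix applied to \<open>c\<close> is \<open>(v\<^sub>i N(\<mu>\<^sub>i) - D(\<mu>\<^sub>i)) / \<omega>(\<mu>\<^sub>i)\<close>, so it vanishes exactly when
  \<open>n N - d D\<close> vanishes at \<open>\<mu>\<^sub>i\<close>. This polynomial always vanishes at the \<open>\<lambda>\<^sub>j\<close>, and its degree
  is at most \<open>2 \<nu> < k + q\<close>; hence \<open>c\<close> is a null vector iff \<open>n N = d D\<close>. By coprimality and the
  degree bounds this means \<open>N = h d\<close> and \<open>D = h n\<close> for a constant \<open>h\<close>, and evaluating
  \<open>N\<close> at \<open>\<lambda>\<^sub>j\<close> gives \<open>c\<^sub>j = h \<gamma>\<^sub>j d(\<lambda>\<^sub>j)\<close>. The resulting equivalences are
  \<open>vandermonde_null_iff\<close> and \<open>loewner_null_iff\<close>.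
\<close>

section \<open>Barycentric interpolation\<close>

definition nodal :: "(nat \<Rightarrow> complex) \<Rightarrow> nat set \<Rightarrow> complex poly" where
  "nodal lam A = (\<Prod>i\<in>A. [:- lam i, 1:])"

text \<open>
  The argument \<open>y\<close> lists the numerators of the partial fractions \<open>y\<^sub>j / (s - \<lambda>\<^sub>j)\<close>, not the
  interpolated values; these differ by the factors \<open>\<gamma>\<^sub>j\<close>.
\<close>

definition barycentric :: "nat \<Rightarrow> (nat \<Rightarrow> complex) \<Rightarrow> (nat \<Rightarrow> complex) \<Rightarrow> complex poly" where
  "barycentric k lam y = (\<Sum>j<k. Polynomial.smult (y j) (nodal lam ({..<k} - {j})))"

lemma poly_nodal: "poly (nodal lam A) s = (\<Prod>i\<in>A. s - lam i)"
  by (simp add: nodal_def poly_prod)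

lemma poly_nodal_eq_0_iff:
  "finite A \<Longrightarrow> poly (nodal lam A) s = 0 \<longleftrightarrow> s \<in> lam ` A"
  by (auto simp: poly_nodal)

lemma degree_nodal: "finite A \<Longrightarrow> degree (nodal lam A) = card A"
  unfolding nodal_def by (subst degree_prod_eq_sum_degree) auto

lemma lead_coeff_nodal: "lead_coeff (nodal lam A) = 1"
  unfolding nodal_def by (simp add: lead_coeff_prod)

lemma lagrange_coeff_eq_inverse_nodal:
  "lagrange_coeff k lam j = 1 / poly (nodal lam ({..<k} - {j})) (lam j)"
  by (simp add: lagrange_coeff_def poly_nodal)

lemma lagrange_coeff_nonzero:
  assumes "inj_on lam {..<k}" "j < k"
  shows "lagrange_coeff k lam j \<noteq> 0"
  using assms by (auto simp: lagrange_coeff_eq_inverse_nodal poly_nodal_eq_0_iff inj_on_def)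

lemma degree_barycentric_le: "degree (barycentric k lam y) \<le> k - 1"
  unfolding barycentric_def
  by (intro degree_sum_le order.trans[OF degree_smult_le]) (auto simp: degree_nodal)

text \<open>Each summand is a multiple of a monic polynomial of degree exactly \<open>k - 1\<close>.\<close>

lemma coeff_barycentric: "coeff (barycentric k lam y) (k - 1) = (\<Sum>j<k. y j)"
proof -
  have "coeff (nodal lam ({..<k} - {j})) (k - 1) = 1" if "j < k" for j
    using lead_coeff_nodal[of lam "{..<k} - {j}"] that by (simp add: degree_nodal)
  then show ?thesis
    by (simp add: barycentric_def coeff_sum)
qed

lemma poly_barycentric_node:
  assumes "j < k"
  shows "poly (barycentric k lam y) (lam j) = y j / lagrange_coeff k lam j"
proof -
  have "poly (barycentric k lam y) (lam j)
      = (\<Sum>i<k. y i * poly (nodal lam ({..<k} - {i})) (lam j))"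
    by (simp add: barycentric_def poly_sum)
  also have "\<dots> = (\<Sum>i<k. if i = j then y j * poly (nodal lam ({..<k} - {j})) (lam j) else 0)"
    using assms by (intro sum.cong) (auto simp: poly_nodal_eq_0_iff)
  also have "\<dots> = y j / lagrange_coeff k lam j"
    using assms by (simp add: lagrange_coeff_eq_inverse_nodal)
  finally show ?thesis .
qed

lemma sum_partial_fractions:
  assumes "s \<notin> lam ` {..<k}"
  shows "(\<Sum>j<k. y j / (s - lam j)) = poly (barycentric k lam y) s / poly (nodal lam {..<k}) s"
proof -
  have nz: "s - lam j \<noteq> 0" if "j < k" for j
    using assms that by auto
  have "poly (nodal lam {..<k}) s = (s - lam j) * poly (nodal lam ({..<k} - {j})) s" if "j < k" for j
    using that by (simp add: poly_nodal prod.remove[of "{..<k}" j])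
  moreover have "poly (nodal lam {..<k}) s \<noteq> 0"
    using assms by (simp add: poly_nodal_eq_0_iff)
  ultimately have "y j / (s - lam j)
      = y j * poly (nodal lam ({..<k} - {j})) s / poly (nodal lam {..<k}) s" if "j < k" for j
    using that nz[OF that] by (simp only:) simp
  then show ?thesis
    by (simp add: barycentric_def poly_sum sum_divide_distrib)
qed

text \<open>
  Lagrange interpolation: both sides have degree less than \<open>k\<close>, and the weights \<open>\<gamma>\<^sub>j\<close> cancel
  the factors \<open>\<omega>\<^sub>j(\<lambda>\<^sub>j)\<close>, so that the sides agree at \<open>k\<close> points.
\<close>

lemma barycentric_interpolation:
  assumes "inj_on lam {..<k}" "degree p < k"
  shows "barycentric k lam (\<lambda>j. lagrange_coeff k lam j * poly p (lam j)) = p"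
proof (rule poly_eqI_degree[where A = "lam ` {..<k}"])
  show "card (lam ` {..<k}) > degree p"
    using assms by (simp add: card_image)
  show "card (lam ` {..<k})
      > degree (barycentric k lam (\<lambda>j. lagrange_coeff k lam j * poly p (lam j)))"
    using assms le_less_trans[OF degree_barycentric_le, of k k] by (simp add: card_image)
qed (use assms(1) lagrange_coeff_nonzero in \<open>auto simp: poly_barycentric_node\<close>)

text \<open>
  The sum is the coefficient of degree \<open>k - 1\<close> of the interpolant of \<open>p\<close>, hence of \<open>p\<close>
  (the divided difference of \<open>p\<close> at all \<open>k\<close> points).
\<close>

lemma lagrange_coeff_annihilates:
  assumes "inj_on lam {..<k}" "degree p < k - 1"
  shows "(\<Sum>j<k. lagrange_coeff k lam j * poly p (lam j)) = 0"
proof -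
  have "(\<Sum>j<k. lagrange_coeff k lam j * poly p (lam j)) = coeff p (k - 1)"
    using barycentric_interpolation[of lam k p]
      coeff_barycentric[of k lam "\<lambda>j. lagrange_coeff k lam j * poly p (lam j)"] assms by simp
  then show ?thesis
    using assms(2) by (simp add: coeff_eq_0)
qed

section \<open>The two null spaces\<close>

text \<open>
  The test polynomial vanishes at all points but \<open>\<lambda>\<^sub>0\<close> and \<open>\<lambda>\<^sub>j\<close>, and omitting two
  linear factors keeps its degree below \<open>k - 1\<close>.
\<close>

lemma annihilator_multiple_of_lagrange_coeff:
  assumes inj: "inj_on lam {..<k}" and "j < k"
    and ann: "\<And>p. degree p < k - 1 \<Longrightarrow> (\<Sum>i<k. c i * poly p (lam i)) = 0"
  shows "c j = c 0 / lagrange_coeff k lam 0 * lagrange_coeff k lam j"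
proof (cases "j = 0")
  case True
  then show ?thesis
    using lagrange_coeff_nonzero[OF inj \<open>j < k\<close>] by simp
next
  case False
  define p where "p = nodal lam ({..<k} - {0, j})"
  have k: "0 < k" using \<open>j < k\<close> by simp
  have deg: "degree p < k - 1"
    using False \<open>j < k\<close> by (simp add: p_def degree_nodal card_Diff_subset)
  have "(\<Sum>i<k. c i * poly p (lam i)) = (\<Sum>i\<in>{0, j}. c i * poly p (lam i))"
    using \<open>j < k\<close> by (intro sum.mono_neutral_right) (auto simp: p_def poly_nodal_eq_0_iff)
  then have balance: "c 0 * poly p (lam 0) + c j * poly p (lam j) = 0"
    using ann[OF deg] False by simp
  have sets: "{..<k} - {0} = insert j ({..<k} - {0, j})" "{..<k} - {j} = insert 0 ({..<k} - {0, j})"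
    using False \<open>j < k\<close> by auto
  have g: "lagrange_coeff k lam 0 = 1 / ((lam 0 - lam j) * poly p (lam 0))"
    "lagrange_coeff k lam j = 1 / ((lam j - lam 0) * poly p (lam j))"
    unfolding lagrange_coeff_def sets p_def poly_nodal by simp_all
  have "lam j \<noteq> lam 0"
    using inj_onD[OF inj, of j 0] False \<open>j < k\<close> k by auto
  moreover have "poly p (lam 0) \<noteq> 0" "poly p (lam j) \<noteq> 0"
    using inj False \<open>j < k\<close> k by (auto simp: p_def poly_nodal_eq_0_iff inj_on_def)
  moreover have "c j * poly p (lam j) = - (c 0 * poly p (lam 0))"
    using balance by (simp add: eq_neg_iff_add_eq_0 add.commute)
  ultimately have "c j = - (c 0 * poly p (lam 0)) / poly p (lam j)"
    by (simp add: field_simps)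
  also have "\<dots> = c 0 / lagrange_coeff k lam 0 * lagrange_coeff k lam j"
    using \<open>lam j \<noteq> lam 0\<close> \<open>poly p (lam j) \<noteq> 0\<close>
    unfolding g by (simp add: divide_simps) (simp add: algebra_simps)
  finally show ?thesis .
qed

lemma vandermonde_null_iff:
  assumes inj: "inj_on lam {..<k}"
  shows "(\<forall>i<k - 1. (\<Sum>j<k. lam j ^ i * c j) = 0)
    \<longleftrightarrow> (\<exists>h. \<forall>j<k. c j = h * lagrange_coeff k lam j)"
proof
  assume null: "\<forall>i<k - 1. (\<Sum>j<k. lam j ^ i * c j) = 0"
  have "(\<Sum>j<k. c j * poly p (lam j)) = 0" if "degree p < k - 1" for p
  proof -
    have "(\<Sum>j<k. c j * poly p (lam j)) = (\<Sum>j<k. \<Sum>i\<le>degree p. coeff p i * (lam j ^ i * c j))"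
      by (simp add: poly_altdef sum_distrib_left mult_ac)
    also have "\<dots> = (\<Sum>i\<le>degree p. coeff p i * (\<Sum>j<k. lam j ^ i * c j))"
      by (subst sum.swap) (simp add: sum_distrib_left)
    also have "\<dots> = 0"
      using null that by (intro sum.neutral) auto
    finally show ?thesis .
  qed
  then show "\<exists>h. \<forall>j<k. c j = h * lagrange_coeff k lam j"
    using annihilator_multiple_of_lagrange_coeff[OF inj, of _ c] by blast
next
  assume "\<exists>h. \<forall>j<k. c j = h * lagrange_coeff k lam j"
  then obtain h where h: "\<And>j. j < k \<Longrightarrow> c j = h * lagrange_coeff k lam j" by blast
  show "\<forall>i<k - 1. (\<Sum>j<k. lam j ^ i * c j) = 0"
  proof (intro allI impI)
    fix i assume "i < k - 1"
    then have "(\<Sum>j<k. lagrange_coeff k lam j * lam j ^ i) = 0"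
      using lagrange_coeff_annihilates[OF inj, of "monom 1 i"]
      by (simp add: degree_monom_eq poly_monom)
    then have "h * (\<Sum>j<k. lagrange_coeff k lam j * lam j ^ i) = 0"
      by simp
    then show "(\<Sum>j<k. lam j ^ i * c j) = 0"
      by (simp add: h sum_distrib_left mult_ac)
  qed
qed

text \<open>
  Coprimality gives \<open>N = d g\<close> and \<open>D = n g\<close>. Whichever of \<open>n\<close> and \<open>d\<close> has the larger degree
  leaves no room for a nonconstant \<open>g\<close>. If \<open>n = 0\<close>, then \<open>d\<close> is a unit and the bound on
  \<open>deg N\<close> is zero.
\<close>

lemma coprime_cross_multiple:
  fixes n d N D :: "complex poly"
  assumes "coprime n d" "n * N = d * D" "d \<noteq> 0"
    and "degree N \<le> max (degree n) (degree d)" "degree D \<le> max (degree n) (degree d)"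
  obtains h where "N = Polynomial.smult h d" "D = Polynomial.smult h n"
proof -
  have "coprime d n" "d dvd n * N"
    using assms(1,2) by (simp_all add: coprime_commute)
  then have "d dvd N"
    by (simp add: coprime_dvd_mult_right_iff)
  then obtain g where N: "N = d * g" by (elim dvdE)
  have D: "D = n * g"
    using assms(2,3) unfolding N by (simp add: mult.left_commute[of n d])
  have "degree g = 0"
  proof (cases "g = 0 \<or> n = 0")
    case True
    then show ?thesis
      using assms(1,3,4) N by (cases "g = 0") (auto simp: degree_mult_eq is_unit_iff_degree)
  next
    case False
    then show ?thesis
      using assms(3-5) N D by (auto simp: degree_mult_eq max_def split: if_splits)
  qed
  then obtain h where "g = [:h:]" by (rule degree_eq_zeroE)
  then show thesis using that[of h] N D by simp
qed

text \<open>
  Row \<open>i\<close> applied to \<open>c\<close> is \<open>v\<^sub>i\<close> times a partial fraction sum minus another such sum, both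
  taken at \<open>\<mu>\<^sub>i\<close>; so \<open>c\<close> is a null vector iff their numerators \<open>N\<close>, \<open>D\<close> satisfy
  \<open>n N = d D\<close> at all \<open>\<mu>\<^sub>i\<close>. At the \<open>\<lambda>\<^sub>j\<close>
  the same equation holds because \<open>w\<^sub>j\<close> interpolates \<open>n / d\<close>; together these are more points than
  the degree allows unless the equation is an identity. Then \<open>N\<close> is a constant multiple of \<open>d\<close>.
\<close>

lemma loewner_null_iff:
  fixes n d :: "complex poly"
  assumes "coprime n d" and k: "k = max (degree n) (degree d) + 1" and "k \<le> q"
    and inj: "inj_on lam {..<k}" "inj_on mu {..<q}"
    and disj: "lam ` {..<k} \<inter> mu ` {..<q} = {}"
    and dlam: "\<And>j. j < k \<Longrightarrow> poly d (lam j) \<noteq> 0"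
    and dmu: "\<And>i. i < q \<Longrightarrow> poly d (mu i) \<noteq> 0"
    and w: "\<And>j. j < k \<Longrightarrow> w j = poly n (lam j) / poly d (lam j)"
    and v: "\<And>i. i < q \<Longrightarrow> v i = poly n (mu i) / poly d (mu i)"
  shows "(\<forall>i<q. (\<Sum>j<k. (v i - w j) / (mu i - lam j) * c j) = 0)
    \<longleftrightarrow> (\<exists>h. \<forall>j<k. c j = h * (lagrange_coeff k lam j * poly d (lam j)))"
proof -
  define N where "N = barycentric k lam c"
  define D where "D = barycentric k lam (\<lambda>j. c j * w j)"
  have "0 < k" using k by simp
  have degN: "degree N \<le> max (degree n) (degree d)" and degD: "degree D \<le> max (degree n) (degree d)"
    using degree_barycentric_le[of k lam] k by (simp_all add: N_def D_def)
  have "d \<noteq> 0" using dlam[OF \<open>0 < k\<close>] by auto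
  have row: "(\<Sum>j<k. (v i - w j) / (mu i - lam j) * c j) = 0
      \<longleftrightarrow> poly (n * N) (mu i) = poly (d * D) (mu i)" if "i < q" for i
  proof -
    have mu: "mu i \<notin> lam ` {..<k}" using disj that by auto
    have eq: "poly n (mu i) = v i * poly d (mu i)"
      using dmu[OF that] v[OF that] by simp
    have "(\<Sum>j<k. (v i - w j) / (mu i - lam j) * c j)
        = v i * (\<Sum>j<k. c j / (mu i - lam j)) - (\<Sum>j<k. c j * w j / (mu i - lam j))"
      by (simp add: sum_distrib_left sum_subtractf[symmetric] diff_divide_distrib algebra_simps)
    also have "\<dots> = (v i * poly N (mu i) - poly D (mu i)) / poly (nodal lam {..<k}) (mu i)"
      by (simp add: sum_partial_fractions[OF mu] N_def D_def diff_divide_distrib)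
    finally have "(\<Sum>j<k. (v i - w j) / (mu i - lam j) * c j) = 0
        \<longleftrightarrow> v i * poly N (mu i) = poly D (mu i)"
      using mu by (simp only:) (simp add: poly_nodal_eq_0_iff)
    also have "\<dots> \<longleftrightarrow> poly (n * N) (mu i) = poly (d * D) (mu i)"
      using dmu[OF that]
      by (simp add: eq mult.left_commute[of "poly d (mu i)"] mult.commute[of "v i"] mult.assoc)
    finally show ?thesis .
  qed
  show ?thesis
  proof
    assume null: "\<forall>i<q. (\<Sum>j<k. (v i - w j) / (mu i - lam j) * c j) = 0"
    have cross: "n * N = d * D"
    proof (rule poly_eqI_degree[where A = "lam ` {..<k} \<union> mu ` {..<q}"])
      fix s assume "s \<in> lam ` {..<k} \<union> mu ` {..<q}"
      then show "poly (n * N) s = poly (d * D) s"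
        using null row dlam by (auto simp: N_def D_def poly_barycentric_node w)
    next
      have card: "card (lam ` {..<k} \<union> mu ` {..<q}) = k + q"
        using inj disj by (simp add: card_Un_disjoint card_image)
      show "degree (n * N) < card (lam ` {..<k} \<union> mu ` {..<q})"
        using degree_mult_le[of n N] degN card k \<open>k \<le> q\<close> by linarith
      show "degree (d * D) < card (lam ` {..<k} \<union> mu ` {..<q})"
        using degree_mult_le[of d D] degD card k \<open>k \<le> q\<close> by linarith
    qed
    obtain h where "N = Polynomial.smult h d"
      using coprime_cross_multiple[OF assms(1) cross \<open>d \<noteq> 0\<close> degN degD] by metis
    then have "c j / lagrange_coeff k lam j = h * poly d (lam j)" if "j < k" for j
      using poly_barycentric_node[OF that, of lam c] by (simp add: N_def)
    then have "\<forall>j<k. c j = h * (lagrange_coeff k lam j * poly d (lam j))"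
      using lagrange_coeff_nonzero[OF inj(1)] by (auto simp: field_simps)
    then show "\<exists>h. \<forall>j<k. c j = h * (lagrange_coeff k lam j * poly d (lam j))" by blast
  next
    assume "\<exists>h. \<forall>j<k. c j = h * (lagrange_coeff k lam j * poly d (lam j))"
    then obtain h where c: "\<And>j. j < k \<Longrightarrow> c j = h * (lagrange_coeff k lam j * poly d (lam j))"
      by blast
    have "N = barycentric k lam (\<lambda>j. lagrange_coeff k lam j * poly (Polynomial.smult h d) (lam j))"
      unfolding N_def barycentric_def by (intro sum.cong) (auto simp: c mult_ac)
    also have "\<dots> = Polynomial.smult h d"
      using inj k by (intro barycentric_interpolation) auto
    finally have N: "N = Polynomial.smult h d" .
    have "D = barycentric k lam (\<lambda>j. lagrange_coeff k lam j * poly (Polynomial.smult h n) (lam j))"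
      unfolding D_def barycentric_def using dlam by (intro sum.cong) (auto simp: c w mult.left_commute)
    also have "\<dots> = Polynomial.smult h n"
      using inj k by (intro barycentric_interpolation) auto
    finally have "n * N = d * D" by (simp add: N mult.commute)
    then show "\<forall>i<q. (\<Sum>j<k. (v i - w j) / (mu i - lam j) * c j) = 0"
      using row by simp
  qed
qed

section \<open>Translation to matrices\<close>

lemma cspan_singleton:
  assumes "u \<in> carrier_vec k"
  shows "cspan k {u} = {h \<cdot>\<^sub>v u | h. True}"
proof -
  interpret vec_space "TYPE(complex)" k .
  have "lincomb a {u} = a u \<cdot>\<^sub>v u" for a
    using assms by (simp add: lincomb_def)
  then show ?thesis
    using assms by (subst finite_span) (auto intro: exI[of _ "\<lambda>_. h" for h])
qed

text \<open>
  Reduces both null spaces to the equivalences about finite sums proved above, in which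
  vectors are functions on the indices below \<open>k\<close>.
\<close>

lemma mat_kernel_eq_cspan_singletonI:
  assumes "\<And>c. (\<forall>i<r. (\<Sum>j<k. f i j * c j) = 0) \<longleftrightarrow> (\<exists>h. \<forall>j<k. c j = h * u j)"
  shows "mat_kernel (mat r k (\<lambda>(i, j). f i j)) = cspan k {vec k u}"
proof -
  have "x \<in> mat_kernel (mat r k (\<lambda>(i, j). f i j)) \<longleftrightarrow> (\<exists>h. x = h \<cdot>\<^sub>v vec k u)"
    if x: "x \<in> carrier_vec k" for x
  proof -
    have "mat r k (\<lambda>(i, j). f i j) *\<^sub>v x = vec r (\<lambda>i. \<Sum>j<k. f i j * x $ j)"
      using x by (intro eq_vecI) (auto simp: scalar_prod_def lessThan_atLeast0)
    then have "x \<in> mat_kernel (mat r k (\<lambda>(i, j). f i j)) \<longleftrightarrow> (\<forall>i<r. (\<Sum>j<k. f i j * x $ j) = 0)"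
      using x by (simp add: mat_kernel_def vec_eq_iff)
    also have "\<dots> \<longleftrightarrow> (\<exists>h. \<forall>j<k. x $ j = h * u j)"
      by (rule assms)
    also have "\<dots> \<longleftrightarrow> (\<exists>h. x = h \<cdot>\<^sub>v vec k u)"
      using x by (simp add: vec_eq_iff)
    finally show ?thesis .
  qed
  moreover have "mat_kernel (mat r k (\<lambda>(i, j). f i j)) \<subseteq> carrier_vec k"
    by (auto simp: mat_kernel_def)
  ultimately have "mat_kernel (mat r k (\<lambda>(i, j). f i j)) = {h \<cdot>\<^sub>v vec k u | h. True}"
    by auto
  then show ?thesis
    by (simp add: cspan_singleton)
qed

theorem theorem2p1:
  fixes n d :: "complex poly"
    and \<nu> k q :: nat
    and lam mu w v :: "nat \<Rightarrow> complex"
  assumes "coprime n d"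
    and "\<nu> = max (degree n) (degree d)"
    and "k = \<nu> + 1"
    and "q > \<nu>"
    and "inj_on lam {..<k}"
    and "inj_on mu {..<q}"
    and "lam ` {..<k} \<inter> mu ` {..<q} = {}"
    and "\<And>j. j < k \<Longrightarrow> poly d (lam j) \<noteq> 0"
    and "\<And>i. i < q \<Longrightarrow> poly d (mu i) \<noteq> 0"
    and "\<And>j. j < k \<Longrightarrow> w j = poly n (lam j) / poly d (lam j)"
    and "\<And>i. i < q \<Longrightarrow> v i = poly n (mu i) / poly d (mu i)"
  shows "mat_kernel (vandermonde_mat \<nu> k lam) = cspan k {lagrange_vec k lam}
    \<and> mat_kernel (loewner_mat q k mu v lam w)
        = cspan k {mat_diag k (\<lambda>j. poly d (lam j)) *\<^sub>v lagrange_vec k lam}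
    \<and> mat_diag k (\<lambda>j. poly d (lam j)) *\<^sub>v lagrange_vec k lam
        = vec k (\<lambda>j. lagrange_coeff k lam j * poly d (lam j))"
proof (intro conjI)
  \<comment> \<open>The Vandermonde matrix has \<open>\<nu> = k - 1\<close> rows: it tests the monomials of degree below \<open>k - 1\<close>.\<close>
  show "mat_kernel (vandermonde_mat \<nu> k lam) = cspan k {lagrange_vec k lam}"
    unfolding vandermonde_mat_def lagrange_vec_def
    using vandermonde_null_iff[OF assms(5)] assms(3)
    by (intro mat_kernel_eq_cspan_singletonI) simp
  show diag: "mat_diag k (\<lambda>j. poly d (lam j)) *\<^sub>v lagrange_vec k lam
      = vec k (\<lambda>j. lagrange_coeff k lam j * poly d (lam j))"
  proof (rule eq_vecI)
    fix i assume "i < dim_vec (vec k (\<lambda>j. lagrange_coeff k lam j * poly d (lam j)))"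
    then have i: "i < k" by simp
    have "(mat_diag k (\<lambda>j. poly d (lam j)) *\<^sub>v lagrange_vec k lam) $ i
        = (\<Sum>j\<in>{0..<k}. (if i = j then poly d (lam j) else 0) * lagrange_coeff k lam j)"
      using i by (simp add: mat_diag_def lagrange_vec_def scalar_prod_def)
    also have "\<dots> = (\<Sum>j\<in>{0..<k}. if i = j then lagrange_coeff k lam j * poly d (lam j) else 0)"
      by (intro sum.cong) auto
    finally show "(mat_diag k (\<lambda>j. poly d (lam j)) *\<^sub>v lagrange_vec k lam) $ i
        = vec k (\<lambda>j. lagrange_coeff k lam j * poly d (lam j)) $ i"
      using i by simp
  qed (simp add: mat_diag_def)
  show "mat_kernel (loewner_mat q k mu v lam w)
      = cspan k {mat_diag k (\<lambda>j. poly d (lam j)) *\<^sub>v lagrange_vec k lam}"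
    unfolding diag loewner_mat_def using assms
    by (intro mat_kernel_eq_cspan_singletonI loewner_null_iff) auto
qed

end
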